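(* Let $E \subseteq \mathbb{R}^+$ and let $0$ be an accumulation point of $E$. Then the inequality $\underline{p}(E) \leq \frac{1}{2}$ holds.
   Context: $\mathbb{R}^+=[0,\infty)$. For $E\subseteq\mathbb{R}^+$ and $h>0$, $\lambda(E,h)$ is the length of the largest open subinterval of $(0,h)$ that contains no point of $E$ (it is $0$ if there is no such nonempty interval). The right lower porosity of $E$ at $0$ is $\underline{p}(E)=\liminf_{h\to0^+}\lambda(E,h)/h$. *)

theory Defs
  imports "HOL-Analysis.Analysis"
begin

text \<open>
  For \<open>a < b\<close>, the condition \<open>{a<..<b} \<subseteq> {0<..<h}\<close> amounts to \<open>0 \<le> a\<close> and \<open>b \<le> h\<close>. The
  degenerate choice \<open>a = b\<close> (empty interval) is admitted, so that the length is \<open>0\<close> when no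
  nonempty interval qualifies. For \<open>h > 0\<close> the supremum is a maximum; see
  \<open>largest_gap_attained\<close>.
\<close>

definition largest_gap :: "real set \<Rightarrow> real \<Rightarrow> real" where
  "largest_gap E h =
     Sup {b - a | a b. 0 \<le> a \<and> a \<le> b \<and> b \<le> h \<and> {a<..<b} \<inter> E = {}}"

definition right_lower_porosity :: "real set \<Rightarrow> ereal" where
  "right_lower_porosity E = Liminf (at_right 0) (\<lambda>h. ereal (largest_gap E h / h))"

lemma largest_gap_attained:
  assumes "h > 0"
  obtains a b where "0 \<le> a" "a \<le> b" "b \<le> h" "{a<..<b} \<inter> E = {}" "largest_gap E h = b - a"
    and "\<And>c d. 0 \<le> c \<Longrightarrow> c \<le> d \<Longrightarrow> d \<le> h \<Longrightarrow> {c<..<d} \<inter> E = {} \<Longrightarrow> d - c \<le> b - a"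
proof -
  define K where "K = ({0..h} \<times> {0..h}) \<inter> ({p. fst p \<le> snd p} \<inter> (\<Inter>e\<in>E. {p. e \<le> fst p} \<union> {p. snd p \<le> e}))"
  have "closed ({p. fst p \<le> snd p} \<inter> (\<Inter>e\<in>E. {p. e \<le> fst p} \<union> {p::real\<times>real. snd p \<le> e}))"
    by (intro closed_Int closed_INT ballI closed_Un closed_Collect_le continuous_intros)
  then have "compact K"
    unfolding K_def by (intro compact_Int_closed compact_Times) auto
  moreover have K_iff: "(a, b) \<in> K \<longleftrightarrow> 0 \<le> a \<and> a \<le> b \<and> b \<le> h \<and> {a<..<b} \<inter> E = {}" for a b
  proof -
    have "(a, b) \<in> K \<longleftrightarrow> 0 \<le> a \<and> a \<le> b \<and> b \<le> h \<and> (\<forall>e\<in>E. e \<le> a \<or> b \<le> e)"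
      unfolding K_def by auto
    also have "(\<forall>e\<in>E. e \<le> a \<or> b \<le> e) \<longleftrightarrow> {a<..<b} \<inter> E = {}"
      by (auto simp: disjoint_iff not_less) (meson not_le)
    finally show ?thesis .
  qed
  moreover have "(0, 0) \<in> K"
    using assms by (simp add: K_iff)
  moreover have "continuous_on K (\<lambda>p. snd p - fst p)"
    by (intro continuous_intros)
  ultimately obtain p where p: "p \<in> K" "\<And>q. q \<in> K \<Longrightarrow> snd q - fst q \<le> snd p - fst p"
    using continuous_attains_sup[of K "\<lambda>p. snd p - fst p"] by blast
  obtain a b where ab: "p = (a, b)"
    by (cases p)
  have max: "d - c \<le> b - a"
    if "0 \<le> c" "c \<le> d" "d \<le> h" "{c<..<d} \<inter> E = {}" for c d
    using p(2)[of "(c, d)"] that by (simp add: K_iff ab)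
  have ab': "0 \<le> a" "a \<le> b" "b \<le> h" "{a<..<b} \<inter> E = {}"
    using p(1) by (simp_all add: K_iff ab)
  moreover have "largest_gap E h = b - a"
    unfolding largest_gap_def using ab' max by (intro cSup_eq_maximum; clarsimp) blast+
  ultimately show ?thesis
    using that max by blast
qed

end

theory Submission
  imports Defs
begin

text \<open>
  A gap of \<open>E\<close> in \<open>(0, 2p)\<close> with \<open>p \<in> E\<close> lies on one side of \<open>p\<close>, so it has length at
  most \<open>p\<close>; the points \<open>h = 2p\<close> accumulate at \<open>0\<close>.
\<close>

lemma largest_gap_double_le:
  assumes "p \<in> E" "p > 0"
  shows "largest_gap E (2 * p) \<le> p"
proof -
  obtain a b where ab: "0 \<le> a" "b \<le> 2 * p" "{a<..<b} \<inter> E = {}" "largest_gap E (2 * p) = b - a"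
    using largest_gap_attained[of "2 * p" E] assms(2) by (metis mult_pos_pos zero_less_numeral)
  have "p \<le> a \<or> b \<le> p"
    using ab(3) assms(1) by (meson disjoint_iff greaterThanLessThan_iff not_le)
  \<comment> \<open>If \<open>p \<le> a\<close>, then \<open>b - a \<le> 2 * p - p\<close>; if
    \<open>b \<le> p\<close>, then \<open>b - a \<le> p - 0\<close>.\<close>
  with ab show ?thesis
    by auto
qed

theorem corollary5p23:
  fixes E :: "real set"
  assumes "E \<subseteq> {0..}"
    and "0 islimpt E"
  shows "right_lower_porosity E \<le> ereal (1 / 2)"
proof (rule ccontr)
  assume "\<not> ?thesis"
  \<comment> \<open>A lower limit above 1/2 keeps the ratio above 1/2 for every small
    \<open>h\<close>, so a single bad \<open>h < d\<close> gives the contradiction.\<close>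
  then have "\<forall>\<^sub>F h in at_right 0. ereal (1 / 2) < ereal (largest_gap E h / h)"
    unfolding right_lower_porosity_def by (intro less_LiminfD) simp
  then obtain d where "d > 0" and d: "\<And>h. 0 < h \<Longrightarrow> h < d \<Longrightarrow> 1 / 2 < largest_gap E h / h"
    by (auto simp: eventually_at_right_field)
  \<comment> \<open>Radius \<open>d / 2\<close> is chosen so that \<open>h = 2 * p\<close> stays
    below \<open>d\<close>; \<open>p > 0\<close> will follow from \<open>p \<noteq> 0\<close> and
    \<open>E \<subseteq> {0..}\<close>.\<close>
  obtain p where p: "p \<in> E" "p \<noteq> 0" "dist p 0 < d / 2"
    using assms(2) \<open>d > 0\<close> unfolding islimpt_approachable by (meson half_gt_zero)
  with assms(1) have "0 < p" "2 * p < d"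
    by (auto simp: dist_real_def)
  with d[of "2 * p"] largest_gap_double_le[OF p(1)] show False
    by (simp add: field_simps)
qed

end
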